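(* Let $f:\mathbf{Z}\to\mathbf{C}$ be a function with $\lVert\hat f\rVert_\infty=N$ and let $D\subset\mathbf{Z}$ be any dissociated set. If $\min_{n\in D}|f(n)|\geqslant 1$, then $$\lVert\hat f\rVert_1\gg\left(\frac{|D|}{\log N}\right)^{1/2}.$$
   Context: For $f:\mathbf{Z}\to\mathbf{C}$, its Fourier transform is the function $\hat f:\mathbf{T}\to\mathbf{C}$, $\hat f(x)=\sum_{n\in\mathbf{Z}}f(n)e(nx)$, where $e(t)=e^{2\pi it}$ and $\mathbf{T}=\mathbf{R}/\mathbf{Z}$ (here $f$ is such that this defines a function on $\mathbf{T}$). $\lVert g\rVert_p=(\int_0^1|g|^p)^{1/p}$ and $\lVert g\rVert_\infty=\sup|g|$. A set $D\subset\mathbf{Z}$ is dissociated if whenever $\sum_{d\in D}\varepsilon_dd=0$ with $\varepsilon_d\in\{-1,0,1\}$ (finitely many nonzero), all $\varepsilon_d=0$. $X\gg Y$ means $X\geqslant cY$ for an absolute constant $c>0$.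
   Formalization: The formal theorem assumes N ≥ 2, since the bound fails as N → 1+ (D = {1}, f = (1+t)δ_1) and is undefined at N = 1; the Fourier series of f is read as an unordered (absolutely convergent) sum. *)

theory Defs
  imports "HOL-Analysis.Analysis"
begin

text \<open>Functions on the torus \<open>\<real>/\<int>\<close> are represented by 1-periodic functions on the reals.\<close>

definition e_of :: "real \<Rightarrow> complex" where
  "e_of t = exp (2 * of_real pi * \<i> * of_real t)"

text \<open>The sum over all integers is the library's unordered sum. It is meaningful at every point
  exactly when \<open>has_fourier_transform f\<close> holds.\<close>

definition has_fourier_transform :: "(int \<Rightarrow> complex) \<Rightarrow> bool" where
  "has_fourier_transform f \<longleftrightarrow>
     (\<forall>x::real. (\<lambda>n::int. f n * e_of (of_int n * x)) summable_on UNIV)"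

definition fourier :: "(int \<Rightarrow> complex) \<Rightarrow> real \<Rightarrow> complex" where
  "fourier f x = (\<Sum>\<^sub>\<infinity>n::int. f n * e_of (of_int n * x))"

definition Lp_norm :: "real \<Rightarrow> (real \<Rightarrow> complex) \<Rightarrow> real" where
  "Lp_norm p g = (LBINT x:{0..1}. norm (g x) powr p) powr (1 / p)"

text \<open>The supremum is that of the reals, hence only meaningful for bounded \<open>g\<close>. The Fourier
  transforms of functions satisfying \<open>has_fourier_transform\<close> are always bounded, since unordered
  summability at 0 is absolute summability of the coefficients.\<close>

definition sup_norm :: "(real \<Rightarrow> complex) \<Rightarrow> real" where
  "sup_norm g = (SUP x. norm (g x))"

definition dissociated :: "int set \<Rightarrow> bool" where
  "dissociated D \<longleftrightarrow>
     (\<forall>\<epsilon>::int \<Rightarrow> int.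
        (\<forall>d\<in>D. \<epsilon> d \<in> {-1, 0, 1}) \<longrightarrow>
        finite {d\<in>D. \<epsilon> d \<noteq> 0} \<longrightarrow>
        (\<Sum>d | d \<in> D \<and> \<epsilon> d \<noteq> 0. \<epsilon> d * d) = 0 \<longrightarrow>
        (\<forall>d\<in>D. \<epsilon> d = 0))"

end

theory Submission imports Defs begin

text \<open>
  Pair \<open>g = fourier f\<close> with the trigonometric polynomial \<open>h\<close> having coefficients \<open>sgn (f d)\<close> on \<open>D\<close>,
  so that \<open>card D \<le> \<integral> \<bar>g\<bar> \<bar>h\<bar>\<close>. Comparison with a Riesz product shows that the real part of \<open>h\<close>, also
  after rotation by a power of \<open>\<i>\<close>, is subgaussian:
  \<open>\<integral> exp (s * Re h) \<le> exp (s\<^sup>2 * card D)\<close>. Instead of going through \<open>L\<^sup>p\<close> norms with \<open>p = ln N\<close>, we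
  play this off against \<open>\<bar>g\<bar> \<le> N\<close> by the Young-type inequality
  \<open>a * b \<le> 2 * a * ln N + exp b / N\<close>, and choose \<open>s\<^sup>2 * card D = ln N\<close>.
\<close>

section \<open>Characters of the torus and their orthogonality\<close>

lemma e_of_0 [simp]: "e_of 0 = 1"
  by (simp add: e_of_def)

lemma e_of_add: "e_of (x + y) = e_of x * e_of y"
  by (simp add: e_of_def algebra_simps exp_add)

lemma norm_e_of [simp]: "norm (e_of x) = 1"
  by (simp add: e_of_def)

lemma cnj_e_of: "cnj (e_of x) = e_of (- x)"
  by (simp add: e_of_def exp_cnj)

lemma e_of_sum: "e_of (sum u A) = (\<Prod>x\<in>A. e_of (u x))"
  by (induction A rule: infinite_finite_induct) (auto simp: e_of_add)

lemma continuous_on_e_of [continuous_intros]: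
  "continuous_on A u \<Longrightarrow> continuous_on A (\<lambda>x. e_of (u x))"
  unfolding e_of_def by (intro continuous_intros)

lemma e_of_int: "e_of (of_int n) = 1"
proof -
  have "e_of (of_int n) = cis (2 * pi * of_int n)"
    by (simp add: e_of_def cis_conv_exp mult_ac)
  then show ?thesis by (simp add: cis_multiple_2pi)
qed

lemma has_integral_e_of:
  "((\<lambda>x. e_of (of_int n * x)) has_integral (if n = 0 then 1 else 0)) {0..1}"
proof (cases "n = 0")
  case True
  then show ?thesis using has_integral_const_real[of "1::complex" 0 1] by simp
next
  case False
  define w where "w = 2 * of_real pi * \<i> * (of_int n :: complex)"
  have "w \<noteq> 0" using False by (simp add: w_def)
  have eq: "e_of (of_int n * x) = exp (w * of_real x)" for x
    by (simp add: e_of_def w_def mult_ac)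
  have "((\<lambda>x. exp (w * of_real x)) has_integral
          (exp (w * of_real 1) / w - exp (w * of_real 0) / w)) {0..1}"
  proof (rule fundamental_theorem_of_calculus)
    fix x :: real
    have "((\<lambda>z. exp (w * z) / w) has_field_derivative exp (w * of_real x)) (at (of_real x))"
      using \<open>w \<noteq> 0\<close> by (auto intro!: derivative_eq_intros)
    then show "((\<lambda>x. exp (w * of_real x) / w) has_vector_derivative exp (w * of_real x))
        (at x within {0..1})"
      by (intro has_vector_derivative_real_field)
  qed auto
  moreover have "exp (w * of_real 1) = 1"
    using eq[of 1] e_of_int[of n] by simp
  ultimately show ?thesis using False by (simp add: eq)
qed

section \<open>Elementary inequalities for \<open>exp\<close> and \<open>cosh\<close>\<close>

lemma cosh_le_exp_square: "cosh x \<le> exp (x\<^sup>2)" for x :: real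
proof -
  have nonneg: "cosh x \<le> exp (x\<^sup>2)" if "x \<ge> 0" for x :: real
  \<comment> \<open>The exponent x^2, in place of the sharp x^2 / 2, permits this crude split:
    quadratic bounds on \<open>exp\<close> up to 1, and cosh x \<le> exp x \<le> exp (x^2)
    beyond.\<close>
  proof (cases "x \<le> 1")
    case True
    have "exp x \<le> 1 + x + x\<^sup>2"
      using exp_bound that True by blast
    moreover have "exp (- x) \<le> 1 - x + x\<^sup>2"
    proof -
      \<comment> \<open>The product on the right is 1 + x^3.\<close>
      have "1 \<le> (1 - x + x\<^sup>2) * (1 + x)"
        using that by (simp add: algebra_simps power2_eq_square)
      also have "\<dots> \<le> (1 - x + x\<^sup>2) * exp x"
        using True by (intro mult_left_mono exp_ge_add_one_self) auto
      finally show ?thesis by (simp add: exp_minus divide_simps)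
    qed
    moreover have "1 + x\<^sup>2 \<le> exp (x\<^sup>2)"
      by (rule exp_ge_add_one_self)
    ultimately have "exp x + exp (- x) \<le> 2 * exp (x\<^sup>2)" by linarith
    then show ?thesis by (simp add: cosh_field_def)
  next
    case False
    have "cosh x \<le> exp x" using that by (simp add: cosh_field_def)
    also have "\<dots> \<le> exp (x\<^sup>2)"
      using False by (simp add: power2_eq_square)
    finally show ?thesis .
  qed
  show ?thesis using nonneg[of x] nonneg[of "- x"] by (cases "x \<ge> 0") auto
qed

text \<open>The right-hand side is the chord of t -> exp (s t) over [-1, 1], so convexity gives the
  bound. Being affine in t, it turns a product of exponentials into a Riesz product.\<close>

lemma exp_mult_le_cosh_sinh:
  fixes s t :: real
  assumes "\<bar>t\<bar> \<le> 1"
  shows "exp (s * t) \<le> cosh s + sinh s * t"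
proof -
  have "exp ((1 - (1 + t) / 2) *\<^sub>R (- s) + ((1 + t) / 2) *\<^sub>R s)
      \<le> (1 - (1 + t) / 2) * exp (- s) + ((1 + t) / 2) * exp s"
    using assms by (intro convex_onD[OF exp_convex]) auto
  also have "(1 - (1 + t) / 2) *\<^sub>R (- s) + ((1 + t) / 2) *\<^sub>R s = s * t"
    by (simp add: field_simps)
  also have "(1 - (1 + t) / 2) * exp (- s) + ((1 + t) / 2) * exp s = cosh s + sinh s * t"
    by (simp add: cosh_field_def sinh_field_def field_simps)
  finally show ?thesis .
qed

section \<open>Dissociated sets and Riesz products\<close>

lemma dissociatedD:
  assumes "dissociated D" "finite D" "\<And>d. d \<in> D \<Longrightarrow> \<epsilon> d \<in> {-1, 0, 1}"
    and "(\<Sum>d\<in>D. \<epsilon> d * d) = 0" "d \<in> D"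
  shows "\<epsilon> d = 0"
proof -
  have "(\<Sum>d | d \<in> D \<and> \<epsilon> d \<noteq> 0. \<epsilon> d * d) = (\<Sum>d\<in>D. \<epsilon> d * d)"
    using assms(2) by (intro sum.mono_neutral_left) auto
  then have "(\<Sum>d | d \<in> D \<and> \<epsilon> d \<noteq> 0. \<epsilon> d * d) = 0"
    using assms(4) by (rule trans)
  moreover have "finite {d \<in> D. \<epsilon> d \<noteq> 0}"
    using assms(2) by simp
  ultimately show ?thesis
    using assms(1,3,5) unfolding dissociated_def by blast
qed

text \<open>Expanding the product gives characters whose frequencies are the sums of
  \<open>\<epsilon> d * d\<close> with \<open>\<epsilon> d\<close> in {-1, 0, 1}. By dissociativity
  only the zero choice has frequency 0, so only its coefficient, a product of the constants A,
  survives integration.\<close>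

lemma has_integral_riesz_product:
  assumes "finite D" "dissociated D"
  shows "((\<lambda>x. \<Prod>d\<in>D. A + B * Re (c d * e_of (of_int d * x))) has_integral A ^ card D) {0..1}"
proof -
  \<comment> \<open>\<open>a d k\<close> is the coefficient of the character of frequency
    \<open>k * d\<close> in the factor of d, obtained from Re w = (w + cnj w) / 2.\<close>
  define a where
    "a d k = (if k = 0 then of_real A else of_real (B / 2) * (if k = 1 then c d else cnj (c d)))"
    for d and k :: int
  define E where "E = PiE D (\<lambda>_. {-1, 0, 1 :: int})"
  \<comment> \<open>Members of \<open>PiE\<close> are \<open>undefined\<close> off D, so the zero
    choice must be restricted to D in order to lie in E.\<close>
  define z where "z = restrict (\<lambda>_. 0 :: int) D"
  have "finite E"
    using assms(1) by (auto simp: E_def intro: finite_PiE)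
  have "z \<in> E"
    by (auto simp: E_def z_def)
  have factor: "of_real (A + B * Re (c d * e_of (of_int d * x))) =
      (\<Sum>k\<in>{-1, 0, 1}. a d k * e_of (of_int (k * d) * x))" for d x
  proof -
    have "of_real (A + B * Re w) = of_real A + of_real (B / 2) * w + of_real (B / 2) * cnj w"
      for w :: complex
      by (simp add: complex_eq_iff)
    from this[of "c d * e_of (of_int d * x)"] show ?thesis
      by (simp add: a_def cnj_e_of mult.assoc)
  qed
  have expand: "of_real (\<Prod>d\<in>D. A + B * Re (c d * e_of (of_int d * x))) =
      (\<Sum>\<epsilon>\<in>E. (\<Prod>d\<in>D. a d (\<epsilon> d)) * e_of (of_int (\<Sum>d\<in>D. \<epsilon> d * d) * x))" for x
  proof -
    have "of_real (\<Prod>d\<in>D. A + B * Re (c d * e_of (of_int d * x))) =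
        (\<Prod>d\<in>D. \<Sum>k\<in>{-1, 0, 1}. a d k * e_of (of_int (k * d) * x))"
      by (simp only: of_real_prod factor)
    also have "\<dots> = (\<Sum>\<epsilon>\<in>E. \<Prod>d\<in>D. a d (\<epsilon> d) * e_of (of_int (\<epsilon> d * d) * x))"
      unfolding E_def using assms(1) by (intro prod_sum_PiE) auto
    also have "\<dots> = (\<Sum>\<epsilon>\<in>E. (\<Prod>d\<in>D. a d (\<epsilon> d)) * e_of (of_int (\<Sum>d\<in>D. \<epsilon> d * d) * x))"
      by (simp add: prod.distrib e_of_sum sum_distrib_right)
    finally show ?thesis .
  qed
  have only_z: "\<epsilon> = z" if "\<epsilon> \<in> E" "(\<Sum>d\<in>D. \<epsilon> d * d) = 0" for \<epsilon>
  proof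
    fix d
    show "\<epsilon> d = z d"
    proof (cases "d \<in> D")
      case True
      have "\<epsilon> d' \<in> {-1, 0, 1}" if "d' \<in> D" for d'
        using \<open>\<epsilon> \<in> E\<close> that unfolding E_def by (rule PiE_mem)
      then have "\<epsilon> d = 0"
        using dissociatedD[OF assms(2,1), of \<epsilon>] that(2) True by blast
      then show ?thesis using True by (simp add: z_def)
    next
      case False
      then show ?thesis using that(1) by (auto simp: E_def z_def)
    qed
  qed
  have "((\<lambda>x. \<Sum>\<epsilon>\<in>E. (\<Prod>d\<in>D. a d (\<epsilon> d)) * e_of (of_int (\<Sum>d\<in>D. \<epsilon> d * d) * x)) has_integral
      (\<Sum>\<epsilon>\<in>E. (\<Prod>d\<in>D. a d (\<epsilon> d)) * (if (\<Sum>d\<in>D. \<epsilon> d * d) = 0 then 1 else 0))) {0..1}"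
    by (intro has_integral_sum has_integral_mult_right has_integral_e_of \<open>finite E\<close>)
  also have "(\<Sum>\<epsilon>\<in>E. (\<Prod>d\<in>D. a d (\<epsilon> d)) * (if (\<Sum>d\<in>D. \<epsilon> d * d) = 0 then 1 else 0)) =
      (\<Sum>\<epsilon>\<in>{z}. \<Prod>d\<in>D. a d (\<epsilon> d))"
  proof (rule sum.mono_neutral_cong_right)
    show "\<forall>\<epsilon>\<in>E - {z}. (\<Prod>d\<in>D. a d (\<epsilon> d)) * (if (\<Sum>d\<in>D. \<epsilon> d * d) = 0 then 1 else 0) = 0"
    proof
      fix \<epsilon> assume "\<epsilon> \<in> E - {z}"
      then have "(\<Sum>d\<in>D. \<epsilon> d * d) \<noteq> 0"
        using only_z[of \<epsilon>] by blast
      then show "(\<Prod>d\<in>D. a d (\<epsilon> d)) * (if (\<Sum>d\<in>D. \<epsilon> d * d) = 0 then 1 else 0) = 0"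
        by simp
    qed
  qed (use \<open>finite E\<close> \<open>z \<in> E\<close> in \<open>auto simp: z_def\<close>)
  also have "\<dots> = of_real (A ^ card D)"
    by (simp add: z_def a_def)
  finally have "((\<lambda>x. complex_of_real (\<Prod>d\<in>D. A + B * Re (c d * e_of (of_int d * x))))
      has_integral of_real (A ^ card D)) {0..1}"
    by (simp only: expand)
  from has_integral_linear[OF this bounded_linear_Re] show ?thesis
    by (simp only: o_def Re_complex_of_real)
qed

text \<open>The exponential factors over D. Replacing each factor by its chord leaves a Riesz
  product with constant term \<open>cosh s\<close>, as if the summands were independent, and
  \<open>cosh s\<close> is at most the exponential of s^2.\<close>

lemma integral_exp_dissociated_le:
  assumes "finite D" "dissociated D" "\<And>d. d \<in> D \<Longrightarrow> norm (c d) \<le> 1"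
  shows "integral {0..1} (\<lambda>x. exp (s * Re (\<Sum>d\<in>D. c d * e_of (of_int d * x))))
      \<le> exp (s\<^sup>2 * card D)"
proof -
  have "integral {0..1} (\<lambda>x. exp (s * Re (\<Sum>d\<in>D. c d * e_of (of_int d * x)))) \<le> cosh s ^ card D"
  proof (rule has_integral_le)
    show "((\<lambda>x. exp (s * Re (\<Sum>d\<in>D. c d * e_of (of_int d * x)))) has_integral
        integral {0..1} (\<lambda>x. exp (s * Re (\<Sum>d\<in>D. c d * e_of (of_int d * x))))) {0..1}"
      by (intro integrable_integral integrable_continuous_real continuous_intros)
    show "((\<lambda>x. \<Prod>d\<in>D. cosh s + sinh s * Re (c d * e_of (of_int d * x))) has_integral
        cosh s ^ card D) {0..1}"
      by (rule has_integral_riesz_product) fact+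
    fix x :: real
    have "exp (s * Re (\<Sum>d\<in>D. c d * e_of (of_int d * x))) =
        (\<Prod>d\<in>D. exp (s * Re (c d * e_of (of_int d * x))))"
      using assms(1) by (simp only: Re_sum sum_distrib_left exp_sum)
    also have "\<dots> \<le> (\<Prod>d\<in>D. cosh s + sinh s * Re (c d * e_of (of_int d * x)))"
    proof (intro prod_mono conjI exp_mult_le_cosh_sinh)
      fix d assume "d \<in> D"
      have "\<bar>Re (c d * e_of (of_int d * x))\<bar> \<le> norm (c d * e_of (of_int d * x))"
        by (rule abs_Re_le_cmod)
      also have "\<dots> \<le> 1"
        using assms(3)[OF \<open>d \<in> D\<close>] by (simp add: norm_mult)
      finally show "\<bar>Re (c d * e_of (of_int d * x))\<bar> \<le> 1" .
    qed auto
    finally show "exp (s * Re (\<Sum>d\<in>D. c d * e_of (of_int d * x))) \<le>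
        (\<Prod>d\<in>D. cosh s + sinh s * Re (c d * e_of (of_int d * x)))" .
  qed
  also have "\<dots> \<le> exp (s\<^sup>2) ^ card D"
    by (intro power_mono cosh_le_exp_square) auto
  also have "\<dots> = exp (s\<^sup>2 * card D)"
    by (simp add: exp_of_nat_mult[symmetric] mult.commute)
  finally show ?thesis .
qed

section \<open>Pointwise inequalities for the pairing\<close>

lemma exp_norm_le_sum_rotations:
  fixes z :: complex
  assumes "s \<ge> 0"
  shows "exp (s / 2 * norm z) \<le> (\<Sum>w\<in>{1, -1, \<i>, -\<i>}. exp (s * Re (w * z)))"
proof -
  \<comment> \<open>The larger of |Re z| and |Im z| is at least half the modulus and equals Re (w z)
    for one of the four rotations w. That single term already dominates, and the others are
    positive.\<close>
  define m where "m = max \<bar>Re z\<bar> \<bar>Im z\<bar>"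
  have "norm z / 2 \<le> m"
    using cmod_le[of z] by (auto simp: m_def)
  then have "s * (norm z / 2) \<le> s * m"
    using assms by (rule mult_left_mono)
  moreover have "m \<in> {Re z, - Re z, Im z, - Im z}"
    by (auto simp: m_def max_def abs_if)
  then have "\<exists>w\<in>{1, -1, \<i>, -\<i>}. m = Re (w * z)"
    by auto
  then obtain w where "w \<in> {1, -1, \<i>, -\<i>}" "m = Re (w * z)"
    by blast
  ultimately have "exp (s / 2 * norm z) \<le> exp (s * Re (w * z))"
    by simp
  also have "\<dots> \<le> (\<Sum>w\<in>{1, -1, \<i>, -\<i>}. exp (s * Re (w * z)))"
    using \<open>w \<in> _\<close> by (intro member_le_sum[where f = "\<lambda>w. exp (s * Re (w * z))"]) auto
  finally show ?thesis .
qed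

text \<open>Up to b = 2 ln N the first term suffices. Beyond it the excess u = b - 2 ln N satisfies
  u \<le> exp u, and a \<le> N. The factor 2 is what leaves exp b divided by N, so that an integral
  of exp b of order N costs only a constant.\<close>

lemma mult_le_ln_plus_exp:
  fixes a b N :: real
  assumes "0 \<le> a" "a \<le> N" "N > 0"
  shows "a * b \<le> 2 * a * ln N + exp b / N"
proof (cases "b \<le> 2 * ln N")
  case True
  then have "a * b \<le> a * (2 * ln N)"
    using assms by (intro mult_left_mono)
  also have "\<dots> \<le> 2 * a * ln N + exp b / N"
    using assms by simp
  finally show ?thesis .
next
  case False
  have "b - 2 * ln N \<le> exp (b - 2 * ln N)"
    using exp_ge_add_one_self[of "b - 2 * ln N"] by linarith
  then have "a * (b - 2 * ln N) \<le> N * exp (b - 2 * ln N)"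
    using False assms by (intro mult_mono) auto
  also have "\<dots> = exp b / N"
    using assms by (simp add: exp_diff exp_double power2_eq_square)
  finally show ?thesis by (simp add: algebra_simps)
qed

section \<open>Fourier transforms: continuity, boundedness, recovery of coefficients\<close>

context
  fixes f :: "int \<Rightarrow> complex"
  assumes f: "has_fourier_transform f"
begin

lemma summable_norm_coeffs: "(\<lambda>n. norm (f n)) summable_on UNIV"
proof -
  have "f summable_on UNIV"
    using f[unfolded has_fourier_transform_def, rule_format, of 0] by simp
  then show ?thesis
    by (simp add: summable_on_iff_abs_summable_on_complex)
qed

text \<open>Absolute summability forbids infinitely many coefficients of modulus at least 1.
  Finiteness of D can therefore be a conclusion of the theorem and not an assumption.\<close>

lemma finite_coeffs_ge_1:
  assumes "\<forall>n\<in>D. norm (f n) \<ge> 1"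
  shows "finite D"
proof -
  have "(\<lambda>n. norm (f n)) summable_on D"
    using summable_norm_coeffs by (rule summable_on_subset_banach) simp
  then have "(\<lambda>_. 1 :: real) summable_on D"
    by (rule summable_on_comparison_test) (use assms in auto)
  then show ?thesis
    using infsum_diverge_constant[of D "1 :: real"] by auto
qed

text \<open>Characters have modulus 1, so the summable \<open>norm (f n)\<close> is a majorant. The
  uniformity yields continuity and termwise integration.\<close>

lemma uniform_limit_fourier:
  "uniform_limit UNIV (\<lambda>X x. \<Sum>n\<in>X. f n * e_of (of_int n * x)) (fourier f)
    (finite_subsets_at_top UNIV)"
  unfolding fourier_def
  by (rule Weierstrass_m_test_general[OF _ summable_norm_coeffs]) (simp add: norm_mult)

lemma continuous_on_fourier: "continuous_on A (fourier f)"
proof (rule continuous_on_subset)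
  show "continuous_on UNIV (fourier f)"
    by (rule uniform_limit_theorem[OF _ uniform_limit_fourier])
      (auto intro!: always_eventually continuous_intros)
qed simp

lemma norm_fourier_le_sup_norm: "norm (fourier f x) \<le> sup_norm (fourier f)"
  unfolding sup_norm_def
proof (rule cSUP_upper)
  \<comment> \<open>A real supremum bounds its members only if the set is bounded above; the sum of
    the moduli of the coefficients is such a bound.\<close>
  have "norm (fourier f x) \<le> (\<Sum>\<^sub>\<infinity>n. norm (f n))" for x
  proof -
    have "norm (fourier f x) \<le> (\<Sum>\<^sub>\<infinity>n. norm (f n * e_of (of_int n * x)))"
      unfolding fourier_def
      by (rule norm_infsum_bound) (simp add: norm_mult summable_norm_coeffs)
    then show ?thesis by (simp add: norm_mult)
  qed
  then show "bdd_above (range (\<lambda>x. norm (fourier f x)))"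
    by (auto intro!: bdd_aboveI)
qed simp

text \<open>By orthogonality the finite partial sums, multiplied by the conjugate character,
  integrate to exactly \<open>f m\<close> as soon as the index set contains m. Uniform convergence
  carries this to the limit.\<close>

lemma has_integral_fourier_coeff:
  "((\<lambda>x. fourier f x * e_of (- (of_int m * x))) has_integral f m) {0..1}"
proof -
  define F where "F X x = (\<Sum>n\<in>X. f n * e_of (of_int n * x)) * e_of (- (of_int m * x))"
    for X :: "int set" and x
  have F_eq: "F X = (\<lambda>x. \<Sum>n\<in>X. f n * e_of (of_int (n - m) * x))" for X
  proof
    fix x
    have "e_of (of_int n * x) * e_of (- (of_int m * x)) = e_of (of_int (n - m) * x)" for n
      by (simp add: e_of_add[symmetric] algebra_simps)
    then show "F X x = (\<Sum>n\<in>X. f n * e_of (of_int (n - m) * x))"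
      by (simp add: F_def sum_distrib_right mult.assoc)
  qed
  have F_lim: "uniform_limit {0..1} F (\<lambda>x. fourier f x * e_of (- (of_int m * x)))
      (finite_subsets_at_top UNIV)"
  proof (rule uniform_limitI)
    fix e :: real assume "e > 0"
    show "\<forall>\<^sub>F X in finite_subsets_at_top UNIV.
        \<forall>x\<in>{0..1}. dist (F X x) (fourier f x * e_of (- (of_int m * x))) < e"
      \<comment> \<open>Multiplication by a character of modulus 1 preserves distances.\<close>
      using uniform_limitD[OF uniform_limit_fourier \<open>e > 0\<close>]
      by eventually_elim
        (simp add: F_def dist_norm norm_mult left_diff_distrib[symmetric])
  qed
  obtain I J where I: "\<And>X. (F X has_integral I X) {0..1}"
    and J: "((\<lambda>x. fourier f x * e_of (- (of_int m * x))) has_integral J) {0..1}"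
    and lim: "(I \<longlongrightarrow> J) (finite_subsets_at_top UNIV)"
  proof (rule uniform_limit_integral[OF F_lim])
    show "continuous_on {0..1} (F X)" for X
      unfolding F_def by (intro continuous_intros)
  qed auto
  have "I X = f m" if "finite X" "m \<in> X" for X
  proof -
    have "(F X has_integral (\<Sum>n\<in>X. f n * (if n - m = 0 then 1 else 0))) {0..1}"
      unfolding F_eq by (intro has_integral_sum has_integral_mult_right has_integral_e_of that)
    then have "I X = (\<Sum>n\<in>X. f n * (if n - m = 0 then 1 else 0))"
      using I has_integral_unique by blast
    also have "\<dots> = (\<Sum>n\<in>X. if n = m then f n else 0)"
      by (intro sum.cong) auto
    also have "\<dots> = f m" using that by simp
    finally show ?thesis .
  qed
  then have "\<forall>\<^sub>F X in finite_subsets_at_top UNIV. I X = f m"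
    by (auto simp: eventually_finite_subsets_at_top intro!: exI[of _ "{m}"])
  then have "(I \<longlongrightarrow> f m) (finite_subsets_at_top UNIV)"
    by (rule tendsto_eventually)
  then have "J = f m"
    using lim by (intro tendsto_unique[OF _ lim]) auto
  then show ?thesis using J by simp
qed

section \<open>Lower bounds for the L^1 norm\<close>

lemma Lp_norm_1_fourier: "Lp_norm 1 (fourier f) = integral {0..1} (\<lambda>x. norm (fourier f x))"
proof -
  have "set_integrable lborel {0..1} (\<lambda>x. norm (fourier f x))"
    by (intro borel_integrable_atLeastAtMost' continuous_intros continuous_on_fourier)
  then show ?thesis
    by (simp add: Lp_norm_def set_borel_integral_eq_integral(2) integral_nonneg
        set_borel_integral_eq_integral(1))
qed

text \<open>For nonempty D this makes the L^1 norm at least 1, which later absorbs an additive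
  constant.\<close>

lemma norm_coeff_le_Lp_norm_1: "norm (f n) \<le> Lp_norm 1 (fourier f)"
proof -
  have "norm (integral {0..1} (\<lambda>x. fourier f x * e_of (- (of_int n * x)))) \<le>
      integral {0..1} (\<lambda>x. norm (fourier f x))"
    by (intro integral_norm_bound_integral integrable_continuous_real continuous_intros
        continuous_on_fourier) (simp add: norm_mult)
  then show ?thesis
    by (simp add: integral_unique[OF has_integral_fourier_coeff] Lp_norm_1_fourier)
qed

text \<open>Integrating the transform against the conjugate of the polynomial h with coefficients
  \<open>sgn (f d)\<close> gives the sum of cnj (sgn z) z = |z| over z = \<open>f d\<close>.\<close>

lemma sum_norm_coeffs_le_integral:
  "(\<Sum>d\<in>D. norm (f d)) \<le>
    integral {0..1} (\<lambda>x. norm (fourier f x) * norm (\<Sum>d\<in>D. sgn (f d) * e_of (of_int d * x)))"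
proof (cases "finite D")
  case True
  define h where "h x = (\<Sum>d\<in>D. sgn (f d) * e_of (of_int d * x))" for x
  have cont_h: "continuous_on A h" for A
    unfolding h_def by (intro continuous_intros)
  have "((\<lambda>x. \<Sum>d\<in>D. cnj (sgn (f d)) * (fourier f x * e_of (- (of_int d * x)))) has_integral
      (\<Sum>d\<in>D. cnj (sgn (f d)) * f d)) {0..1}"
    by (intro has_integral_sum has_integral_mult_right has_integral_fourier_coeff True)
  also have "(\<lambda>x. \<Sum>d\<in>D. cnj (sgn (f d)) * (fourier f x * e_of (- (of_int d * x)))) =
      (\<lambda>x. fourier f x * cnj (h x))"
    by (simp add: h_def cnj_e_of sum_distrib_left mult_ac)
  also have "(\<Sum>d\<in>D. cnj (sgn (f d)) * f d) = of_real (\<Sum>d\<in>D. norm (f d))"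
  proof -
    have "cnj (sgn z) * z = of_real (norm z)" for z :: complex
      by (cases "z = 0")
        (simp_all add: sgn_eq complex_norm_square[symmetric] power2_eq_square mult.commute)
    then show ?thesis by simp
  qed
  finally have "of_real (\<Sum>d\<in>D. norm (f d)) = integral {0..1} (\<lambda>x. fourier f x * cnj (h x))"
    by (simp only: integral_unique)
  then have "\<bar>\<Sum>d\<in>D. norm (f d)\<bar> = norm (integral {0..1} (\<lambda>x. fourier f x * cnj (h x)))"
    by (metis norm_of_real)
  also have "\<dots> \<le> integral {0..1} (\<lambda>x. norm (fourier f x) * norm (h x))"
    by (intro integral_norm_bound_integral integrable_continuous_real continuous_intros
        continuous_on_fourier cont_h) (simp add: norm_mult)
  finally show ?thesis by (simp add: h_def)
\<comment> \<open>For infinite D both sums over D are 0 by convention.\<close>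
qed simp

text \<open>The Young-type inequality is applied pointwise with a = |fourier f x| and b = (s / 2) |h
  x|, then integrated. The parameter s stays free until it can be balanced against N.\<close>

lemma card_le_Lp_norm_1:
  fixes N s :: real
  assumes "finite D" "dissociated D" "\<forall>n\<in>D. norm (f n) \<ge> 1"
    and "sup_norm (fourier f) \<le> N" "N > 0" "s \<ge> 0"
  shows "s / 2 * card D \<le> 2 * ln N * Lp_norm 1 (fourier f) + 4 * exp (s\<^sup>2 * card D) / N"
proof -
  define h where "h x = (\<Sum>d\<in>D. sgn (f d) * e_of (of_int d * x))" for x
  define R where "R w x = exp (s * Re (w * h x))" for w x
  have cont_h: "continuous_on A h" for A
    unfolding h_def by (intro continuous_intros)
  have cont_R: "continuous_on A (R w)" for A w
    unfolding R_def by (intro continuous_intros cont_h)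
  have R_le: "integral {0..1} (R w) \<le> exp (s\<^sup>2 * card D)" if "norm w \<le> 1" for w
  proof -
    \<comment> \<open>A rotation only changes the coefficients, without enlarging their modulus, so
      the subgaussian bound holds for every rotated h.\<close>
    have "w * h x = (\<Sum>d\<in>D. (w * sgn (f d)) * e_of (of_int d * x))" for x
      by (simp add: h_def sum_distrib_left mult.assoc)
    then have "R w = (\<lambda>x. exp (s * Re (\<Sum>d\<in>D. (w * sgn (f d)) * e_of (of_int d * x))))"
      by (intro ext) (simp only: R_def)
    moreover have "norm (w * sgn (f d)) \<le> 1" for d
      using that by (simp add: norm_mult norm_sgn)
    ultimately show ?thesis
      using integral_exp_dissociated_le[OF assms(1,2), of "\<lambda>d. w * sgn (f d)" s] by simp
  qed
  have "real (card D) \<le> (\<Sum>d\<in>D. norm (f d))"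
    using sum_mono[of D "\<lambda>_. 1" "\<lambda>d. norm (f d)"] assms(3) by simp
  also have "\<dots> \<le> integral {0..1} (\<lambda>x. norm (fourier f x) * norm (h x))"
    unfolding h_def by (rule sum_norm_coeffs_le_integral)
  \<comment> \<open>The scaling is s / 2 because passing from |h| to real parts of rotations loses a
    factor 2.\<close>
  finally have "s / 2 * card D \<le> s / 2 * integral {0..1} (\<lambda>x. norm (fourier f x) * norm (h x))"
    using assms by (intro mult_left_mono) auto
  also have "\<dots> = integral {0..1} (\<lambda>x. norm (fourier f x) * (s / 2 * norm (h x)))"
    by (simp add: mult_ac flip: integral_mult_right)
  also have "\<dots> \<le> integral {0..1}
      (\<lambda>x. 2 * ln N * norm (fourier f x) + (\<Sum>w\<in>{1, -1, \<i>, -\<i>}. R w x) / N)"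
  proof (rule integral_le)
    fix x :: real
    have "norm (fourier f x) * (s / 2 * norm (h x)) \<le>
        2 * norm (fourier f x) * ln N + exp (s / 2 * norm (h x)) / N"
      using norm_fourier_le_sup_norm[of x] assms by (intro mult_le_ln_plus_exp) auto
    also have "\<dots> \<le> 2 * norm (fourier f x) * ln N + (\<Sum>w\<in>{1, -1, \<i>, -\<i>}. R w x) / N"
      unfolding R_def using assms
      by (intro add_left_mono divide_right_mono exp_norm_le_sum_rotations) auto
    finally show "norm (fourier f x) * (s / 2 * norm (h x)) \<le>
        2 * ln N * norm (fourier f x) + (\<Sum>w\<in>{1, -1, \<i>, -\<i>}. R w x) / N"
      by (simp add: mult_ac)
  qed (intro integrable_continuous_real continuous_intros continuous_on_fourier cont_h cont_R;
      use assms in simp)+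
  also have "\<dots> = 2 * ln N * integral {0..1} (\<lambda>x. norm (fourier f x)) +
      (\<Sum>w\<in>{1, -1, \<i>, -\<i>}. integral {0..1} (R w)) / N"
    by (intro integral_unique has_integral_add has_integral_mult_right has_integral_divide
        has_integral_sum integrable_integral integrable_continuous_real continuous_intros
        continuous_on_fourier cont_R) auto
  also have "\<dots> \<le> 2 * ln N * integral {0..1} (\<lambda>x. norm (fourier f x)) +
      (\<Sum>w\<in>{1, -1, \<i>, -\<i>}. exp (s\<^sup>2 * card D)) / N"
    using assms by (intro add_left_mono divide_right_mono sum_mono R_le) auto
  \<comment> \<open>The sum ranges over a set, so the four rotations have to be shown distinct;
    \<open>complex_eq_iff\<close> separates them.\<close>
  also have "(\<Sum>w\<in>{1, -1, \<i>, -\<i>}. exp (s\<^sup>2 * card D)) = 4 * exp (s\<^sup>2 * card D)"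
    by (simp add: complex_eq_iff)
  finally show ?thesis
    by (simp add: Lp_norm_1_fourier)
qed

end

section \<open>Balancing the parameter s\<close>

theorem theorem5p1:
  "\<exists>c::real. c > 0 \<and>
     (\<forall>(f :: int \<Rightarrow> complex) (D :: int set) (N :: real).
        has_fourier_transform f \<longrightarrow>
        sup_norm (fourier f) = N \<longrightarrow>
        N \<ge> 2 \<longrightarrow>
        dissociated D \<longrightarrow>
        (\<forall>n\<in>D. norm (f n) \<ge> 1) \<longrightarrow>
        finite D \<and> Lp_norm 1 (fourier f) \<ge> c * sqrt (real (card D) / ln N))"
\<comment> \<open>The 20 is 2 * (2 + 8): the coefficient 2 of the logarithmic term, 8 from absorbing
  the additive 4, and a doubling to clear s / 2.\<close>
proof (rule exI[of _ "1 / 20"], intro conjI allI impI)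
  fix f :: "int \<Rightarrow> complex" and D :: "int set" and N :: real
  assume f: "has_fourier_transform f" and N: "sup_norm (fourier f) = N" "N \<ge> 2"
    and D: "dissociated D" "\<forall>n\<in>D. norm (f n) \<ge> 1"
  show "finite D"
    using f D(2) by (rule finite_coeffs_ge_1)
  show "Lp_norm 1 (fourier f) \<ge> 1 / 20 * sqrt (real (card D) / ln N)"
  \<comment> \<open>For empty D the bound is 0. Otherwise s may be divided by \<open>card D\<close>,
    and some coefficient has modulus at least 1.\<close>
  proof (cases "D = {}")
    case True
    then show ?thesis by (simp add: Lp_norm_def)
  next
    case False
    define L where "L = ln N"
    define I where "I = Lp_norm 1 (fourier f)"
    \<comment> \<open>The largest s for which the exponential term is at most 4.\<close>
    define s where "s = sqrt (L / card D)"
    have "card D > 0"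
      using \<open>finite D\<close> False by (simp add: card_gt_0_iff)
    \<comment> \<open>Here \<open>N \<ge> 2\<close> keeps the logarithm away from 0. Near N = 1 no
      absolute constant works: if f is 1 + \<epsilon> at one nonzero point forming D, and 0
      elsewhere, the L^1 norm is 1 + \<epsilon> while \<open>card D / ln N\<close> is unbounded as
      \<epsilon> tends to 0.\<close>
    have "ln 2 \<le> L"
      unfolding L_def using N by (subst ln_le_cancel_iff) auto
    then have "L \<ge> 1 / 2"
      using ln2_ge_two_thirds by simp
    obtain d where "d \<in> D" using False by auto
    then have "1 \<le> I"
      using D(2) norm_coeff_le_Lp_norm_1[OF f, of d] by (auto simp: I_def)
    then have "1 / 2 \<le> I * L"
      using mult_mono[of 1 I "1 / 2" L] \<open>L \<ge> 1 / 2\<close> by simp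
    have "s \<ge> 0"
      using \<open>L \<ge> 1 / 2\<close> by (simp add: s_def)
    have "s\<^sup>2 * card D = L"
      using \<open>L \<ge> 1 / 2\<close> \<open>card D > 0\<close> by (simp add: s_def)
    then have "exp (s\<^sup>2 * card D) = N"
      using N by (simp add: L_def)
    then have "s / 2 * card D \<le> 2 * L * I + 4"
      using card_le_Lp_norm_1[OF f \<open>finite D\<close> D, of N s] N \<open>s \<ge> 0\<close> by (simp add: L_def I_def)
    \<comment> \<open>Since I L \<ge> 1 / 2, the additive 4 is at most 8 I L.\<close>
    also have "\<dots> \<le> 10 * (I * L)"
      using \<open>1 / 2 \<le> I * L\<close> by simp
    finally have "s * card D \<le> 20 * I * L" by simp
    moreover have "s * card D = sqrt (card D / L) * L"
    proof -
      have "s * card D = sqrt L * (card D / sqrt (card D))"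
        by (simp add: s_def real_sqrt_divide)
      also have "\<dots> = sqrt L * sqrt (card D)"
        by (simp add: real_div_sqrt)
      also have "\<dots> = (L / sqrt L) * sqrt (card D)"
        using \<open>L \<ge> 1 / 2\<close> by (simp add: real_div_sqrt)
      also have "\<dots> = sqrt (card D / L) * L"
        by (simp add: real_sqrt_divide)
      finally show ?thesis .
    qed
    ultimately have "sqrt (card D / L) \<le> 20 * I"
      using \<open>L \<ge> 1 / 2\<close> by (simp add: mult_le_cancel_right)
    then show ?thesis by (simp add: L_def I_def)
  qed
qed simp

end
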